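(* Let $\mathcal{M}$ be a Kripke model, and let $ue(\mathcal{M})$ be its ($\exists\forall$-version) ultrafilter extension for contingency logic. Then $ue(\mathcal{M})$ is $\mathcal{L}(\nabla)$-saturated.
   Context: A Kripke model is $\mathcal{M}=\langle S,R,V\rangle$ with $S\neq\emptyset$, $R\subseteq S\times S$, $V:\mathbf{P}\to\mathcal{P}(S)$, where $\mathbf{P}$ is the set of propositional variables. $\mathcal{L}(\nabla)$ is the propositional language with $\neg,\wedge$ and a unary operator $\nabla$ (contingency); $\Delta\phi$ abbreviates $\neg\nabla\phi$. Semantics: $\mathcal{M},s\vDash\nabla\phi$ iff there are $t,u\in S$ with $Rst$, $Rsu$, $\mathcal{M},t\vDash\phi$ and $\mathcal{M},u\nvDash\phi$; Booleans as usual. For $X\subseteq S$, $\overline{X}=S\setminus X$ and $m_\nabla(X)=\{s\in S\mid Rst,Rsu\text{ for some }t\in X\text{ and some }u\notin X\}$, $m_\Delta(X)=\{s\in S\mid\text{for all }t,u,\text{ if }Rst\text{ and }Rsu,\text{ then }(t\in X\text{ iff }u\in X)\}$. Ultrafilter extension ($\exists\forall$-version): $ue(\mathcal{M})=\langle Uf(S),R^{ue},V^{ue}\rangle$, where $Uf(S)$ is the set of all ultrafilters over $S$; $R^{ue}st$ iff there exists $X\subseteq S$ such that $m_\nabla(X)\in s$ and, for all $Y\subseteq S$, if $m_\Delta(Y)\cap m_\Delta(\overline{X}\cup Y)\in s$, then $Y\in t$; and $V^{ue}(p)=\{s\in Uf(S)\mid V(p)\in s\}$. A Kripke model is $\mathcal{L}(\nabla)$-saturated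 if for every state $s$ and every $\Gamma\subseteq\mathcal{L}(\nabla)$: if $\Gamma$ is finitely satisfiable in the set of successors of $s$ (every finite subset of $\Gamma$ is true, all formulas simultaneously, at some successor of $s$), then $\Gamma$ is satisfiable in the set of successors of $s$ (some successor of $s$ satisfies all of $\Gamma$). *)

theory Defs
  imports Main
begin

record ('w, 'p) kripke =
  states :: "'w set"
  rel :: "('w \<times> 'w) set"
  val :: "'p \<Rightarrow> 'w set"

definition kripke_model :: "('w, 'p) kripke \<Rightarrow> bool" where
  "kripke_model M \<longleftrightarrow>
     states M \<noteq> {} \<and> rel M \<subseteq> states M \<times> states M \<and> (\<forall>p. val M p \<subseteq> states M)"

datatype 'p form =
    Prop 'p
  | Neg "'p form"
  | Conj "'p form" "'p form"
  | Nabla "'p form"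

primrec sat :: "('w, 'p) kripke \<Rightarrow> 'w \<Rightarrow> 'p form \<Rightarrow> bool" where
  "sat M s (Prop p) \<longleftrightarrow> s \<in> val M p"
| "sat M s (Neg \<phi>) \<longleftrightarrow> \<not> sat M s \<phi>"
| "sat M s (Conj \<phi> \<psi>) \<longleftrightarrow> sat M s \<phi> \<and> sat M s \<psi>"
| "sat M s (Nabla \<phi>) \<longleftrightarrow>
     (\<exists>t\<in>states M. \<exists>u\<in>states M.
        (s, t) \<in> rel M \<and> (s, u) \<in> rel M \<and> sat M t \<phi> \<and> \<not> sat M u \<phi>)"

definition m_nabla :: "('w, 'p) kripke \<Rightarrow> 'w set \<Rightarrow> 'w set" where
  "m_nabla M X =
     {s \<in> states M. \<exists>t\<in>X. \<exists>u\<in>states M - X. (s, t) \<in> rel M \<and> (s, u) \<in> rel M}"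

definition m_delta :: "('w, 'p) kripke \<Rightarrow> 'w set \<Rightarrow> 'w set" where
  "m_delta M X =
     {s \<in> states M. \<forall>t\<in>states M. \<forall>u\<in>states M.
        (s, t) \<in> rel M \<longrightarrow> (s, u) \<in> rel M \<longrightarrow> (t \<in> X \<longleftrightarrow> u \<in> X)}"

definition ultrafilter_on :: "'w set \<Rightarrow> 'w set set \<Rightarrow> bool" where
  "ultrafilter_on S U \<longleftrightarrow>
     U \<subseteq> Pow S \<and> S \<in> U \<and>
     (\<forall>X\<in>U. \<forall>Y\<in>U. X \<inter> Y \<in> U) \<and>
     (\<forall>X\<in>U. \<forall>Y. X \<subseteq> Y \<longrightarrow> Y \<subseteq> S \<longrightarrow> Y \<in> U) \<and>
     (\<forall>X. X \<subseteq> S \<longrightarrow> (X \<in> U \<longleftrightarrow> S - X \<notin> U))"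

text \<open>The states of the extension are ultrafilters, i.e. sets of sets of states of \<open>M\<close>,
  so the carrier is in general a proper subset of its type.\<close>

definition ue :: "('w, 'p) kripke \<Rightarrow> ('w set set, 'p) kripke" where
  "ue M =
     \<lparr> states = {s. ultrafilter_on (states M) s},
       rel = {(s, t). ultrafilter_on (states M) s \<and> ultrafilter_on (states M) t \<and>
                (\<exists>X. X \<subseteq> states M \<and> m_nabla M X \<in> s \<and>
                   (\<forall>Y. Y \<subseteq> states M \<longrightarrow>
                      m_delta M Y \<inter> m_delta M ((states M - X) \<union> Y) \<in> s \<longrightarrow> Y \<in> t))},
       val = (\<lambda>p. {s. ultrafilter_on (states M) s \<and> val M p \<in> s}) \<rparr>"

definition satisfiable_in :: "('w, 'p) kripke \<Rightarrow> 'w set \<Rightarrow> 'p form set \<Rightarrow> bool" where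
  "satisfiable_in M A \<Gamma> \<longleftrightarrow> (\<exists>t\<in>A. \<forall>\<phi>\<in>\<Gamma>. sat M t \<phi>)"

definition finitely_satisfiable_in :: "('w, 'p) kripke \<Rightarrow> 'w set \<Rightarrow> 'p form set \<Rightarrow> bool" where
  "finitely_satisfiable_in M A \<Gamma> \<longleftrightarrow>
     (\<forall>\<Gamma>'. \<Gamma>' \<subseteq> \<Gamma> \<longrightarrow> finite \<Gamma>' \<longrightarrow> satisfiable_in M A \<Gamma>')"

definition successors :: "('w, 'p) kripke \<Rightarrow> 'w \<Rightarrow> 'w set" where
  "successors M s = {t \<in> states M. (s, t) \<in> rel M}"

definition nabla_saturated :: "('w, 'p) kripke \<Rightarrow> bool" where
  "nabla_saturated M \<longleftrightarrow>
     (\<forall>s\<in>states M. \<forall>\<Gamma>. finitely_satisfiable_in M (successors M s) \<Gamma> \<longrightarrow>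
                          satisfiable_in M (successors M s) \<Gamma>)"

lemma kripke_model_ue:
  assumes "kripke_model M"
  shows "kripke_model (ue M)"
proof -
  obtain w where "w \<in> states M"
    using assms by (auto simp: kripke_model_def)
  then have "ultrafilter_on (states M) {X. X \<subseteq> states M \<and> w \<in> X}"
    by (auto simp: ultrafilter_on_def)
  then show ?thesis
    by (auto simp: kripke_model_def ue_def)
qed

end

theory Submission
  imports Defs
begin

text \<open>
  The relation of the extension looks unlike the one known from modal logic, but at a point of
  \<open>m_nabla M X\<close> the set \<open>m_delta M Y \<inter> m_delta M ((states M - X) \<union> Y)\<close> just says that all
  successors lie in \<open>Y\<close>: by its first part all or none of them do, and they are split by \<open>X\<close>,
  so if none of them lay in \<open>Y\<close>, then the complement of \<open>X\<close> joined with \<open>Y\<close> would still split them (lemma \<open>m_delta_Int_iff_box\<close>).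
  Hence an ultrafilter \<open>s\<close> that contains no set of the form \<open>m_nabla M X\<close> has no successors, and
  the successors of any other \<open>s\<close> are the ultrafilters that extend the filter of all \<open>Y\<close> with
  \<open>box M Y \<in> s\<close>, exactly as for the normal modality \<open>box\<close> (lemma \<open>rel_ue_iff\<close>).

  The successors of \<open>s\<close> are therefore a closed set in a compact space. Concretely, the
  ultrafilter theorem provides a successor of \<open>s\<close> containing a given family of sets as soon as
  no finite part of the family is incompatible with the filter (lemma \<open>ex_successor_ue\<close>). This
  fact is used twice. With a family of one set it yields the two successors that a true formula
  \<open>Nabla \<phi>\<close> needs, so that a formula holds at an ultrafilter iff its truth set is a
  member (lemma \<open>sat_ue_iff\<close>). With the family of the truth sets of a set \<open>\<Gamma>\<close> of formulas it
  turns finite satisfiability of \<open>\<Gamma>\<close> among the successors into satisfiability.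
\<close>

section \<open>The ultrafilter theorem\<close>

lemma
  assumes "ultrafilter_on S U"
  shows ultrafilter_on_subset: "X \<in> U \<Longrightarrow> X \<subseteq> S"
    and ultrafilter_on_top: "S \<in> U"
    and ultrafilter_on_Int: "X \<in> U \<Longrightarrow> Y \<in> U \<Longrightarrow> X \<inter> Y \<in> U"
    and ultrafilter_on_mono: "X \<in> U \<Longrightarrow> X \<subseteq> Y \<Longrightarrow> Y \<subseteq> S \<Longrightarrow> Y \<in> U"
    and ultrafilter_on_compl: "X \<subseteq> S \<Longrightarrow> S - X \<in> U \<longleftrightarrow> X \<notin> U"
proof -
  have sub: "U \<subseteq> Pow S" and top: "S \<in> U"
    and int: "\<forall>X\<in>U. \<forall>Y\<in>U. X \<inter> Y \<in> U"
    and up: "\<forall>X\<in>U. \<forall>Y. X \<subseteq> Y \<longrightarrow> Y \<subseteq> S \<longrightarrow> Y \<in> U"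
    and compl: "\<forall>X. X \<subseteq> S \<longrightarrow> (X \<in> U \<longleftrightarrow> S - X \<notin> U)"
    using assms unfolding ultrafilter_on_def by - (elim conjE, assumption)+
  show "X \<in> U \<Longrightarrow> X \<subseteq> S" using sub by blast
  show "S \<in> U" by (rule top)
  show "X \<in> U \<Longrightarrow> Y \<in> U \<Longrightarrow> X \<inter> Y \<in> U" using int by blast
  show "X \<in> U \<Longrightarrow> X \<subseteq> Y \<Longrightarrow> Y \<subseteq> S \<Longrightarrow> Y \<in> U" using up by blast
  show "X \<subseteq> S \<Longrightarrow> S - X \<in> U \<longleftrightarrow> X \<notin> U" using compl by blast
qed

lemma ultrafilter_on_Int_iff:
  assumes "ultrafilter_on S U" "X \<subseteq> S" "Y \<subseteq> S"
  shows "X \<inter> Y \<in> U \<longleftrightarrow> X \<in> U \<and> Y \<in> U"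
  using assms ultrafilter_on_Int ultrafilter_on_mono by (metis inf_le1 inf_le2)

lemma ultrafilter_on_empty:
  assumes "ultrafilter_on S U"
  shows "{} \<notin> U"
  using ultrafilter_on_compl[OF assms, of "{}"] ultrafilter_on_top[OF assms] by simp

lemma ultrafilter_on_disjoint:
  assumes "ultrafilter_on S U" "X \<in> U" "X \<inter> Y = {}"
  shows "Y \<notin> U"
  using assms ultrafilter_on_Int ultrafilter_on_empty by metis

lemma ultrafilter_on_Un:
  assumes U: "ultrafilter_on S U" and "X \<union> Y \<in> U"
  shows "X \<in> U \<or> Y \<in> U"
proof (rule ccontr)
  assume "\<not> (X \<in> U \<or> Y \<in> U)"
  moreover have "X \<subseteq> S" "Y \<subseteq> S"
    using ultrafilter_on_subset[OF U \<open>X \<union> Y \<in> U\<close>] by auto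
  ultimately have "(S - X) \<inter> (S - Y) \<in> U"
    using U by (simp add: ultrafilter_on_Int ultrafilter_on_compl)
  then show False
    using ultrafilter_on_disjoint[OF U, of "(S - X) \<inter> (S - Y)" "X \<union> Y"] \<open>X \<union> Y \<in> U\<close> by blast
qed

lemma ultrafilter_on_finite_Inter:
  assumes U: "ultrafilter_on S U" and "finite F" "F \<subseteq> U"
  shows "S \<inter> \<Inter>F \<in> U"
  using assms(2,3)
proof (induction F rule: finite_induct)
  case empty
  then show ?case using ultrafilter_on_top[OF U] by simp
next
  case (insert X F)
  then have "X \<inter> (S \<inter> \<Inter>F) \<in> U"
    using ultrafilter_on_Int[OF U] by auto
  then show ?case by (simp add: Int_left_commute)
qed

text \<open>The intersection is taken inside \<open>S\<close>, so that the empty subfamily contributes \<open>S\<close>.\<close>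

definition has_fip :: "'a set \<Rightarrow> 'a set set \<Rightarrow> bool" where
  "has_fip S B \<longleftrightarrow> B \<subseteq> Pow S \<and> (\<forall>F. F \<subseteq> B \<longrightarrow> finite F \<longrightarrow> S \<inter> \<Inter>F \<noteq> {})"

lemma has_fip_Union_chain:
  assumes "C \<noteq> {}" "subset.chain {B. has_fip S B} C"
  shows "has_fip S (\<Union>C)"
proof -
  have fip: "has_fip S B" if "B \<in> C" for B
    using assms(2) that by (auto simp: subset_chain_def)
  have "S \<inter> \<Inter>F \<noteq> {}" if F: "F \<subseteq> \<Union>C" "finite F" for F
  proof -
    obtain B where "B \<in> C" "F \<subseteq> B"
      using finite_subset_Union_chain[OF F(2,1) assms] by blast
    then show ?thesis using fip F(2) by (auto simp: has_fip_def)
  qed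
  moreover have "\<Union>C \<subseteq> Pow S" using fip unfolding has_fip_def by blast
  ultimately show ?thesis by (simp add: has_fip_def)
qed

text \<open>
  A set that meets every finite intersection of the family can be added to it, so maximality
  makes it a member. Each closure property of an ultrafilter is an instance of this.
\<close>

lemma maximal_fip_is_ultrafilter:
  assumes U: "has_fip S U" and max: "\<And>B. has_fip S B \<Longrightarrow> U \<subseteq> B \<Longrightarrow> B = U"
  shows "ultrafilter_on S U"
proof -
  have sub: "U \<subseteq> Pow S" using U by (simp add: has_fip_def)
  have fip: "S \<inter> \<Inter>F \<noteq> {}" if "F \<subseteq> U" "finite F" for F
    using U that by (simp add: has_fip_def)
  have member: "X \<in> U"
    if X: "X \<subseteq> S" and meets: "\<And>F. F \<subseteq> U \<Longrightarrow> finite F \<Longrightarrow> S \<inter> \<Inter>F \<inter> X \<noteq> {}" for X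
  proof -
    have "S \<inter> \<Inter>F \<noteq> {}" if "F \<subseteq> insert X U" "finite F" for F
    proof -
      have "S \<inter> \<Inter>(F - {X}) \<inter> X \<noteq> {}" using that by (intro meets) auto
      then show ?thesis by blast
    qed
    then have "has_fip S (insert X U)" using X sub by (auto simp: has_fip_def)
    then show ?thesis using max[of "insert X U"] by blast
  qed
  have Int: "X \<inter> Y \<in> U" if "X \<in> U" "Y \<in> U" for X Y
  proof (rule member)
    fix F assume "F \<subseteq> U" "finite F"
    then have "S \<inter> \<Inter>(insert X (insert Y F)) \<noteq> {}" using that by (intro fip) auto
    then show "S \<inter> \<Inter>F \<inter> (X \<inter> Y) \<noteq> {}" by auto
  qed (use that sub in auto)
  have up: "Y \<in> U" if "X \<in> U" "X \<subseteq> Y" "Y \<subseteq> S" for X Y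
  proof (rule member)
    fix F assume "F \<subseteq> U" "finite F"
    then have "S \<inter> \<Inter>(insert X F) \<noteq> {}" using that by (intro fip) auto
    then show "S \<inter> \<Inter>F \<inter> Y \<noteq> {}" using \<open>X \<subseteq> Y\<close> by auto
  qed (use that in auto)
  have not_both: "S - X \<notin> U" if "X \<in> U" for X
    using fip[of "{X, S - X}"] that by auto
  have one_of: "X \<in> U" if X: "X \<subseteq> S" and "S - X \<notin> U" for X
  proof (rule member)
    obtain G where G: "G \<subseteq> U" "finite G" "S \<inter> \<Inter>G \<inter> (S - X) = {}"
      using member[of "S - X"] \<open>S - X \<notin> U\<close> by blast
    fix F assume "F \<subseteq> U" "finite F"
    then have "S \<inter> \<Inter>(F \<union> G) \<noteq> {}" using G by (intro fip) auto
    then show "S \<inter> \<Inter>F \<inter> X \<noteq> {}" using G(3) by auto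
  qed (use X in auto)
  have "S \<in> U"
    using fip by (intro member) auto
  moreover have "\<forall>X\<in>U. \<forall>Y\<in>U. X \<inter> Y \<in> U" using Int by blast
  moreover have "\<forall>X\<in>U. \<forall>Y. X \<subseteq> Y \<longrightarrow> Y \<subseteq> S \<longrightarrow> Y \<in> U" using up by blast
  moreover have "X \<in> U \<longleftrightarrow> S - X \<notin> U" if "X \<subseteq> S" for X
    using not_both one_of[OF that] by blast
  ultimately show ?thesis
    unfolding ultrafilter_on_def by (intro conjI allI impI sub)
qed

lemma ex_ultrafilter_extending_fip:
  assumes "has_fip S B"
  obtains U where "ultrafilter_on S U" "B \<subseteq> U"
proof -
  let ?A = "{B'. has_fip S B' \<and> B \<subseteq> B'}"
  have maximal: "\<exists>U\<in>?A. \<forall>B'\<in>?A. U \<subseteq> B' \<longrightarrow> B' = U"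
  proof (rule subset_Zorn_nonempty)
    show "?A \<noteq> {}" using assms by blast
    fix C assume C: "C \<noteq> {}" "subset.chain ?A C"
    then have "subset.chain {B. has_fip S B} C" by (auto simp: subset_chain_def)
    then have "has_fip S (\<Union>C)" by (rule has_fip_Union_chain[OF C(1)])
    moreover have "B \<subseteq> \<Union>C" using C unfolding subset_chain_def by blast
    ultimately show "\<Union>C \<in> ?A" by simp
  qed
  obtain U where U: "has_fip S U" "B \<subseteq> U"
    and max: "\<forall>B'\<in>?A. U \<subseteq> B' \<longrightarrow> B' = U"
    using maximal by auto
  have "ultrafilter_on S U"
  proof (rule maximal_fip_is_ultrafilter[OF U(1)])
    fix B' assume "has_fip S B'" "U \<subseteq> B'"
    with U(2) max show "B' = U" by simp
  qed
  then show ?thesis using that U(2) by blast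
qed

section \<open>Successors in the ultrafilter extension\<close>

definition box :: "('w, 'p) kripke \<Rightarrow> 'w set \<Rightarrow> 'w set" where
  "box M Y = {w \<in> states M. successors M w \<subseteq> Y}"

lemma m_nabla_subset: "m_nabla M X \<subseteq> states M"
  by (auto simp: m_nabla_def)

lemma box_subset: "box M Y \<subseteq> states M"
  by (auto simp: box_def)

lemma box_mono: "Y \<subseteq> Z \<Longrightarrow> box M Y \<subseteq> box M Z"
  by (auto simp: box_def)

text \<open>Contingency of a set is the failure of both necessity and impossibility.\<close>

lemma m_nabla_eq_compl_box:
  assumes "X \<subseteq> states M"
  shows "m_nabla M X = states M - (box M X \<union> box M (states M - X))"
  using assms by (auto simp: m_nabla_def box_def successors_def)

lemma m_delta_Int_iff_box:
  assumes "w \<in> m_nabla M X" "X \<subseteq> states M" "Y \<subseteq> states M"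
  shows "w \<in> m_delta M Y \<inter> m_delta M ((states M - X) \<union> Y) \<longleftrightarrow> w \<in> box M Y"
proof
  obtain t u where w: "w \<in> states M"
    and t: "t \<in> states M" "t \<in> X" "(w, t) \<in> rel M"
    and u: "u \<in> states M" "u \<notin> X" "(w, u) \<in> rel M"
    using assms(1,2) by (auto simp: m_nabla_def)
  assume "w \<in> m_delta M Y \<inter> m_delta M ((states M - X) \<union> Y)"
  then have Y: "w \<in> m_delta M Y" and XY: "w \<in> m_delta M ((states M - X) \<union> Y)"
    by blast+
  have "t \<in> (states M - X) \<union> Y \<longleftrightarrow> u \<in> (states M - X) \<union> Y"
    using XY t u unfolding m_delta_def by blast
  \<comment> \<open>\<open>u\<close> lies outside \<open>X\<close>, so the second condition forces \<open>t\<close>, which lies in \<open>X\<close>, into \<open>Y\<close>.\<close>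
  then have "t \<in> Y" using t u by blast
  then have "successors M w \<subseteq> Y"
    using Y t unfolding m_delta_def successors_def by blast
  then show "w \<in> box M Y" using w by (simp add: box_def)
next
  assume "w \<in> box M Y"
  then show "w \<in> m_delta M Y \<inter> m_delta M ((states M - X) \<union> Y)"
    by (auto simp: box_def m_delta_def successors_def)
qed

lemma rel_ue_iff:
  assumes s: "ultrafilter_on (states M) s"
  shows "(s, t) \<in> rel (ue M) \<longleftrightarrow> ultrafilter_on (states M) t \<and>
    (\<exists>X\<subseteq>states M. m_nabla M X \<in> s) \<and> (\<forall>Y\<subseteq>states M. box M Y \<in> s \<longrightarrow> Y \<in> t)"
proof -
  let ?D = "\<lambda>X Y. m_delta M Y \<inter> m_delta M ((states M - X) \<union> Y)"
  have D_iff: "?D X Y \<in> s \<longleftrightarrow> box M Y \<in> s"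
    if X: "X \<subseteq> states M" "m_nabla M X \<in> s" and Y: "Y \<subseteq> states M" for X Y
  proof -
    have D: "?D X Y \<subseteq> states M" by (auto simp: m_delta_def)
    have "m_nabla M X \<inter> ?D X Y = m_nabla M X \<inter> box M Y"
      using m_delta_Int_iff_box[OF _ X(1) Y] by blast
    then show ?thesis
      using ultrafilter_on_Int_iff[OF s m_nabla_subset D, of X]
        ultrafilter_on_Int_iff[OF s m_nabla_subset box_subset, of X Y] X(2) by simp
  qed
  have forced: "(\<forall>Y. Y \<subseteq> states M \<longrightarrow> ?D X Y \<in> s \<longrightarrow> Y \<in> t) \<longleftrightarrow>
      (\<forall>Y\<subseteq>states M. box M Y \<in> s \<longrightarrow> Y \<in> t)"
    if "X \<subseteq> states M" "m_nabla M X \<in> s" for X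
    by (simp add: D_iff[OF that] cong: imp_cong)
  have "(s, t) \<in> rel (ue M) \<longleftrightarrow> ultrafilter_on (states M) t \<and>
      (\<exists>X. X \<subseteq> states M \<and> m_nabla M X \<in> s \<and>
        (\<forall>Y. Y \<subseteq> states M \<longrightarrow> ?D X Y \<in> s \<longrightarrow> Y \<in> t))"
    unfolding ue_def using s by simp
  then show ?thesis by (simp add: forced cong: conj_cong) blast
qed

lemma states_ue: "states (ue M) = {s. ultrafilter_on (states M) s}"
  by (simp add: ue_def)

lemma successors_ue_ultrafilter: "t \<in> successors (ue M) s \<Longrightarrow> ultrafilter_on (states M) t"
  by (simp add: successors_def states_ue)

lemma box_finite_Inter:
  assumes s: "ultrafilter_on (states M) s" and "finite F" "\<forall>Y\<in>F. box M Y \<in> s"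
  shows "box M (states M \<inter> \<Inter>F) \<in> s"
proof -
  have "states M \<inter> \<Inter>(box M ` F) \<in> s"
    using assms by (intro ultrafilter_on_finite_Inter) auto
  moreover have "states M \<inter> \<Inter>(box M ` F) = box M (states M \<inter> \<Inter>F)"
    by (auto simp: box_def successors_def)
  ultimately show ?thesis by simp
qed

text \<open>
  Compactness of the successor set: the sets whose box belongs to \<open>s\<close> are closed under finite
  intersections, so they have the finite intersection property together with \<open>C\<close> unless they
  include the complement of some finite intersection of members of \<open>C\<close>.
\<close>

lemma ex_successor_ue:
  assumes s: "ultrafilter_on (states M) s"
    and X: "X \<subseteq> states M" "m_nabla M X \<in> s"
    and C: "C \<subseteq> Pow (states M)"
    and compat: "\<And>D. D \<subseteq> C \<Longrightarrow> finite D \<Longrightarrow> box M (states M - \<Inter>D) \<notin> s"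
  obtains t where "t \<in> successors (ue M) s" "C \<subseteq> t"
proof -
  let ?S = "states M"
  let ?F = "{Y. Y \<subseteq> ?S \<and> box M Y \<in> s}"
  have "?S \<inter> \<Inter>G \<noteq> {}" if G: "G \<subseteq> ?F \<union> C" "finite G" for G
  proof
    assume empty: "?S \<inter> \<Inter>G = {}"
    let ?Y = "?S \<inter> \<Inter>(G \<inter> ?F)"
    have "box M ?Y \<in> s"
      using G(2) by (intro box_finite_Inter[OF s]) auto
    moreover have "G = (G \<inter> ?F) \<union> (G \<inter> C)" using G(1) by blast
    then have "\<Inter>G = \<Inter>(G \<inter> ?F) \<inter> \<Inter>(G \<inter> C)" by (metis Inter_Un_distrib)
    then have "?Y \<subseteq> ?S - \<Inter>(G \<inter> C)" using empty by blast
    then have "box M ?Y \<subseteq> box M (?S - \<Inter>(G \<inter> C))" by (rule box_mono)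
    ultimately have "box M (?S - \<Inter>(G \<inter> C)) \<in> s"
      using ultrafilter_on_mono[OF s _ _ box_subset] by blast
    then show False using compat[of "G \<inter> C"] G(2) by blast
  qed
  then have "has_fip ?S (?F \<union> C)" using C by (auto simp: has_fip_def)
  then obtain t where t: "ultrafilter_on ?S t" "?F \<union> C \<subseteq> t"
    by (rule ex_ultrafilter_extending_fip)
  then have "t \<in> successors (ue M) s"
    using X by (auto simp: successors_def states_ue rel_ue_iff[OF s])
  then show ?thesis using that t(2) by blast
qed

section \<open>Truth and saturation\<close>

definition truth_set :: "('w, 'p) kripke \<Rightarrow> 'p form \<Rightarrow> 'w set" where
  "truth_set M \<phi> = {w \<in> states M. sat M w \<phi>}"

lemma truth_set_subset: "truth_set M \<phi> \<subseteq> states M"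
  by (auto simp: truth_set_def)

lemma truth_set_simps:
  "kripke_model M \<Longrightarrow> truth_set M (Prop p) = val M p"
  "truth_set M (Neg \<phi>) = states M - truth_set M \<phi>"
  "truth_set M (Conj \<phi> \<psi>) = truth_set M \<phi> \<inter> truth_set M \<psi>"
  "truth_set M (Nabla \<phi>) = m_nabla M (truth_set M \<phi>)"
  by (auto simp: truth_set_def m_nabla_def kripke_model_def)

text \<open>
  If \<open>m_nabla M A\<close> belongs to \<open>s\<close>, then neither \<open>A\<close> nor its complement is
  forced on the successors, so both can be realised. Otherwise \<open>s\<close>, being prime, contains
  \<open>box M A\<close> or the box of the complement, and all successors agree about \<open>A\<close>.
\<close>

lemma m_nabla_mem_iff:
  assumes s: "ultrafilter_on (states M) s" and A: "A \<subseteq> states M"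
  shows "m_nabla M A \<in> s \<longleftrightarrow>
    (\<exists>t\<in>successors (ue M) s. \<exists>u\<in>successors (ue M) s. A \<in> t \<and> A \<notin> u)"
proof
  let ?S = "states M"
  assume nabla: "m_nabla M A \<in> s"
  have no_box: "box M A \<notin> s" "box M (?S - A) \<notin> s"
    using ultrafilter_on_disjoint[OF s nabla] unfolding m_nabla_eq_compl_box[OF A] by blast+
  have realise: "\<exists>t\<in>successors (ue M) s. B \<in> t" if "B \<subseteq> ?S" "box M (?S - B) \<notin> s" for B
  proof -
    have "box M (?S - \<Inter>D) \<notin> s" if D: "D \<subseteq> {B}" for D
    proof -
      have "box M (?S - \<Inter>D) \<subseteq> box M (?S - B)"
        using D by (intro box_mono) auto
      then show ?thesis
        using \<open>box M (?S - B) \<notin> s\<close> ultrafilter_on_mono[OF s _ _ box_subset] by blast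
    qed
    then obtain t where "t \<in> successors (ue M) s" "{B} \<subseteq> t"
      using ex_successor_ue[OF s A nabla, of "{B}"] \<open>B \<subseteq> ?S\<close> by auto
    then show ?thesis by blast
  qed
  obtain t where t: "t \<in> successors (ue M) s" "A \<in> t"
    using realise[OF A no_box(2)] by blast
  obtain u where u: "u \<in> successors (ue M) s" "?S - A \<in> u"
    using realise[of "?S - A"] no_box(1) A by (auto simp: double_diff)
  then have "A \<notin> u"
    using ultrafilter_on_compl[OF successors_ue_ultrafilter A] by blast
  with t u show "\<exists>t\<in>successors (ue M) s. \<exists>u\<in>successors (ue M) s. A \<in> t \<and> A \<notin> u" by blast
next
  let ?S = "states M"
  assume "\<exists>t\<in>successors (ue M) s. \<exists>u\<in>successors (ue M) s. A \<in> t \<and> A \<notin> u"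
  then obtain t u where t: "t \<in> successors (ue M) s" "A \<in> t"
    and u: "u \<in> successors (ue M) s" "A \<notin> u" by blast
  have forced: "Y \<in> v" if "v \<in> successors (ue M) s" "Y \<subseteq> ?S" "box M Y \<in> s" for v Y
    using that rel_ue_iff[OF s] by (auto simp: successors_def)
  show "m_nabla M A \<in> s"
  proof (rule ccontr)
    assume "m_nabla M A \<notin> s"
    then have "box M A \<union> box M (?S - A) \<in> s"
      by (simp add: m_nabla_eq_compl_box[OF A] ultrafilter_on_compl[OF s] box_subset)
    then consider "box M A \<in> s" | "box M (?S - A) \<in> s"
      using ultrafilter_on_Un[OF s] by blast
    then show False
    proof cases
      case 1
      then show False using forced[OF u(1) A] u(2) by blast
    next
      case 2
      then have "?S - A \<in> t" using forced[OF t(1)] by blast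
      then show False
        using ultrafilter_on_compl[OF successors_ue_ultrafilter[OF t(1)] A] t(2) by blast
    qed
  qed
qed

lemma sat_ue_iff:
  assumes M: "kripke_model M" and "ultrafilter_on (states M) s"
  shows "sat (ue M) s \<phi> \<longleftrightarrow> truth_set M \<phi> \<in> s"
  using assms(2)
proof (induction \<phi> arbitrary: s)
  case (Prop p)
  then show ?case by (simp add: truth_set_simps M) (simp add: ue_def)
next
  case (Neg \<phi>)
  then show ?case
    by (simp add: truth_set_simps ultrafilter_on_compl truth_set_subset)
next
  case (Conj \<phi> \<psi>)
  then show ?case
    by (simp add: truth_set_simps ultrafilter_on_Int_iff[OF Conj.prems] truth_set_subset)
next
  case (Nabla \<phi>)
  have "sat (ue M) s (Nabla \<phi>) \<longleftrightarrow>
      (\<exists>t\<in>successors (ue M) s. \<exists>u\<in>successors (ue M) s. sat (ue M) t \<phi> \<and> \<not> sat (ue M) u \<phi>)"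
    by (auto simp: successors_def)
  also have "\<dots> \<longleftrightarrow> (\<exists>t\<in>successors (ue M) s. \<exists>u\<in>successors (ue M) s.
      truth_set M \<phi> \<in> t \<and> truth_set M \<phi> \<notin> u)"
    using Nabla.IH successors_ue_ultrafilter by (metis (no_types, lifting))
  also have "\<dots> \<longleftrightarrow> truth_set M (Nabla \<phi>) \<in> s"
    by (simp add: truth_set_simps m_nabla_mem_iff[OF Nabla.prems truth_set_subset])
  finally show ?case .
qed

theorem proposition18:
  fixes M :: "('w, 'p) kripke"
  assumes "kripke_model M"
  shows "nabla_saturated (ue M)"
  unfolding nabla_saturated_def
proof (intro ballI allI impI)
  fix s and \<Gamma> :: "'p form set"
  assume "s \<in> states (ue M)" and fin: "finitely_satisfiable_in (ue M) (successors (ue M) s) \<Gamma>"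
  then have s: "ultrafilter_on (states M) s" by (simp add: states_ue)
  have fin_sat: "\<exists>t\<in>successors (ue M) s. \<forall>\<phi>\<in>\<Gamma>'. sat (ue M) t \<phi>"
    if "\<Gamma>' \<subseteq> \<Gamma>" "finite \<Gamma>'" for \<Gamma>'
    using fin that by (simp add: finitely_satisfiable_in_def satisfiable_in_def)
  \<comment> \<open>The empty subset of \<open>\<Gamma>\<close> already yields some successor, and hence a set contingent at \<open>s\<close>.\<close>
  obtain t0 where "t0 \<in> successors (ue M) s"
    using fin_sat[of "{}"] by auto
  then obtain X where X: "X \<subseteq> states M" "m_nabla M X \<in> s"
    using rel_ue_iff[OF s] by (auto simp: successors_def)
  have compat: "box M (states M - \<Inter>D) \<notin> s" if D: "D \<subseteq> truth_set M ` \<Gamma>" "finite D" for D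
  proof
    assume box: "box M (states M - \<Inter>D) \<in> s"
    obtain \<Gamma>' where \<Gamma>': "\<Gamma>' \<subseteq> \<Gamma>" "finite \<Gamma>'" "D = truth_set M ` \<Gamma>'"
      using finite_subset_image[OF D(2,1)] by blast
    then obtain t where t: "t \<in> successors (ue M) s" "\<forall>\<phi>\<in>\<Gamma>'. sat (ue M) t \<phi>"
      using fin_sat by blast
    have uf: "ultrafilter_on (states M) t" using t(1) by (rule successors_ue_ultrafilter)
    have "D \<subseteq> t" using t(2) by (auto simp: \<Gamma>'(3) sat_ue_iff[OF assms uf])
    then have "states M \<inter> \<Inter>D \<in> t"
      using ultrafilter_on_finite_Inter[OF uf D(2)] by blast
    moreover have "states M - \<Inter>D \<in> t"
      using box t(1) rel_ue_iff[OF s] by (auto simp: successors_def)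
    ultimately show False
      using ultrafilter_on_disjoint[OF uf, of "states M \<inter> \<Inter>D" "states M - \<Inter>D"] by blast
  qed
  have "truth_set M ` \<Gamma> \<subseteq> Pow (states M)" by (auto simp: truth_set_def)
  then obtain t where t: "t \<in> successors (ue M) s" "truth_set M ` \<Gamma> \<subseteq> t"
    using ex_successor_ue[OF s X _ compat] by blast
  then have "\<forall>\<phi>\<in>\<Gamma>. sat (ue M) t \<phi>"
    by (auto simp: sat_ue_iff[OF assms successors_ue_ultrafilter[OF t(1)]])
  then show "satisfiable_in (ue M) (successors (ue M) s) \<Gamma>"
    using t(1) by (auto simp: satisfiable_in_def)
qed

end
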